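(* Let $n,m\ge3$ be odd integers with $3\nmid m$. If $S$ is a strong (resp. skew) Skolem starter in $\mathbb{Z}_n$ and $T$ is a strong (resp. skew) Skolem starter in $\mathbb{Z}_m$, then every cardioidal product $W^c_{ST}$ is a strong (resp. skew) Skolem starter in $\mathbb{Z}_{mn}$.
   Context: For odd $k=2\ell+1$, $\mathbb{Z}_k^*=\mathbb{Z}_k\setminus\{0\}$, ordered $1<\dots<k-1$. A 2-partition of $\mathbb{Z}_k^*$ is a partition into unordered pairs $\{x_i,y_i\}$; it is a starter if $\{\pm(x_i-y_i)\bmod k\}=\mathbb{Z}_k^*$; strong if the sums $x_i+y_i\bmod k$ are nonzero and pairwise distinct; skew if $\{\pm(x_i+y_i)\bmod k\}=\mathbb{Z}_k^*$; Skolem if every pair $\{x,y\}$ with $x<y$ satisfies $y-x\le\ell$. A strong (skew) Skolem starter is a starter that is strong (skew) and Skolem. Cardioidal product: with $n=2q+1$, $m=2p+1$, let $C_m=\{(i,2i\bmod m):1\le i\le m-1\}$, and let $\tilde S$ (resp. $\tilde T$) be any set of ordered pairs obtained by ordering each pair of $S$ (resp. $T$) in either way. $W^c_{ST}$ consists of the unordered pairs $\{nr+x,\ nt+y\}$ (mod $nm$, with $x,y$ represented in $\{0,\dots,n-1\}$) of two types: (i) one pair for each $(x,y)\in\tilde S$ and each $(r,t)\in\{(0,0)\}\cup C_m$; (ii) one pair for each $(r,t)\in\tilde T$ with $x=y=0$. *)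

theory Defs
  imports "HOL-Library.Disjoint_Sets"
begin

text \<open>
  Residues modulo \<open>k\<close> are represented by the integers \<open>0, \<dots>, k - 1\<close>, which also carry the linear
  order used in the Skolem condition. An unordered pair is a two-element set, so a quantification
  over all \<open>x\<close>, \<open>y\<close> with \<open>{x, y} \<in> P\<close> visits each pair in both orders.
\<close>

definition Zstar :: "int \<Rightarrow> int set" where
  "Zstar k = {0..<k} - {0}"

definition two_partition :: "int \<Rightarrow> int set set \<Rightarrow> bool" where
  "two_partition k P \<longleftrightarrow> partition_on (Zstar k) P \<and> (\<forall>p\<in>P. card p = 2)"

definition starter :: "int \<Rightarrow> int set set \<Rightarrow> bool" where
  "starter k P \<longleftrightarrow> two_partition k P \<and>
     {d. \<exists>x y. {x, y} \<in> P \<and> (d = (x - y) mod k \<or> d = (- (x - y)) mod k)} = Zstar k"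

definition strong :: "int \<Rightarrow> int set set \<Rightarrow> bool" where
  "strong k P \<longleftrightarrow>
     (\<forall>x y. {x, y} \<in> P \<longrightarrow> (x + y) mod k \<noteq> 0) \<and>
     (\<forall>x y u v. {x, y} \<in> P \<and> {u, v} \<in> P \<and> {x, y} \<noteq> {u, v} \<longrightarrow> (x + y) mod k \<noteq> (u + v) mod k)"

definition skew :: "int \<Rightarrow> int set set \<Rightarrow> bool" where
  "skew k P \<longleftrightarrow>
     {s. \<exists>x y. {x, y} \<in> P \<and> (s = (x + y) mod k \<or> s = (- (x + y)) mod k)} = Zstar k"

text \<open>For odd \<open>k = 2 * l + 1\<close> the bound below is \<open>l\<close>.\<close>

definition skolem :: "int \<Rightarrow> int set set \<Rightarrow> bool" where
  "skolem k P \<longleftrightarrow> (\<forall>x y. {x, y} \<in> P \<and> x < y \<longrightarrow> y - x \<le> (k - 1) div 2)"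

definition strong_skolem_starter :: "int \<Rightarrow> int set set \<Rightarrow> bool" where
  "strong_skolem_starter k P \<longleftrightarrow> starter k P \<and> strong k P \<and> skolem k P"

definition skew_skolem_starter :: "int \<Rightarrow> int set set \<Rightarrow> bool" where
  "skew_skolem_starter k P \<longleftrightarrow> starter k P \<and> skew k P \<and> skolem k P"

definition cardioid :: "int \<Rightarrow> (int \<times> int) set" where
  "cardioid m = {(i, (2 * i) mod m) | i. 1 \<le> i \<and> i \<le> m - 1}"

text \<open>
  \<open>A\<close> arises from \<open>P\<close> by choosing one of the two orders for each pair: forgetting the order
  is a bijection from \<open>A\<close> onto \<open>P\<close>.
\<close>

definition ordering_of :: "int set set \<Rightarrow> (int \<times> int) set \<Rightarrow> bool" where
  "ordering_of P A \<longleftrightarrow> bij_betw (\<lambda>(x, y). {x, y}) A P"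

definition cardioidal_pairs ::
    "int \<Rightarrow> int \<Rightarrow> (int \<times> int) set \<Rightarrow> (int \<times> int) set \<Rightarrow> int set set" where
  "cardioidal_pairs n m A B =
     {{(n * r + x) mod (n * m), (n * t + y) mod (n * m)} | x y r t.
        (x, y) \<in> A \<and> (r, t) \<in> {(0, 0)} \<union> cardioid m} \<union>
     {{(n * r) mod (n * m), (n * t) mod (n * m)} | r t. (r, t) \<in> B}"

text \<open>The product depends on the chosen orderings, so it is a relation rather than a function.\<close>

definition cardioidal_product ::
    "int \<Rightarrow> int \<Rightarrow> int set set \<Rightarrow> int set set \<Rightarrow> int set set \<Rightarrow> bool" where
  "cardioidal_product n m S T W \<longleftrightarrow>
     (\<exists>A B. ordering_of S A \<and> ordering_of T B \<and> W = cardioidal_pairs n m A B)"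

end

theory Submission
  imports Defs "HOL-Number_Theory.Cong"
begin

text \<open>
  Fix orderings \<open>A\<close> of \<open>S\<close> and \<open>B\<close> of \<open>T\<close>. Modulo \<open>n\<close> an element, difference or sum of the product
  determines whether it comes from \<open>A\<close> or from \<open>B\<close>, and in the first case from which pair \<open>(x, y)\<close>.
  What remains is \<open>r\<close>, \<open>t\<close>, \<open>r - t\<close> or \<open>r + t\<close> modulo \<open>m\<close> with \<open>t = 2r\<close>, that is \<open>r\<close>
  multiplied by 1, 2, \<open>-1\<close> or 3. All of these are units modulo \<open>m\<close>, so each residue occurs
  exactly once. The Skolem bound holds because \<open>r\<close> and \<open>2r mod m\<close> differ by at most
  \<open>(m - 1) / 2\<close>.
\<close>

section \<open>The defining conditions restated for sets of ordered pairs\<close>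

definition unord :: "int \<times> int \<Rightarrow> int set" where
  "unord = (\<lambda>(x, y). {x, y})"

lemma unord_simp [simp]: "unord (x, y) = {x, y}"
  by (simp add: unord_def)

text \<open>Counterpart of \<open>two_partition\<close>. The last clause concludes equality as
  ordered pairs, so together with \<open>x \<noteq> y\<close> it also rules out that
  \<open>A\<close> contains a pair in both orders.\<close>

definition pairing :: "int \<Rightarrow> (int \<times> int) set \<Rightarrow> bool" where
  "pairing k A \<longleftrightarrow>
     (\<forall>x y. (x, y) \<in> A \<longrightarrow> x \<in> Zstar k \<and> y \<in> Zstar k \<and> x \<noteq> y) \<and>
     (\<forall>z\<in>Zstar k. \<exists>x y. (x, y) \<in> A \<and> z \<in> {x, y}) \<and>
     (\<forall>x y u v. (x, y) \<in> A \<and> (u, v) \<in> A \<and> {x, y} \<inter> {u, v} \<noteq> {} \<longrightarrow> x = u \<and> y = v)"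

text \<open>With \<open>s = -1\<close> this is the condition on differences in a starter, with \<open>s = 1\<close> the skew condition.\<close>

definition covers :: "int \<Rightarrow> int \<Rightarrow> (int \<times> int) set \<Rightarrow> bool" where
  "covers k s A \<longleftrightarrow>
     (\<forall>x y. (x, y) \<in> A \<longrightarrow> \<not> k dvd x + s * y) \<and>
     (\<forall>d. \<not> k dvd d \<longrightarrow>
        (\<exists>x y e. (x, y) \<in> A \<and> (e = 1 \<or> e = - 1) \<and> k dvd d - e * (x + s * y)))"

definition sums_distinct :: "int \<Rightarrow> (int \<times> int) set \<Rightarrow> bool" where
  "sums_distinct k A \<longleftrightarrow>
     (\<forall>x y. (x, y) \<in> A \<longrightarrow> \<not> k dvd x + y) \<and>
     (\<forall>x y u v. (x, y) \<in> A \<and> (u, v) \<in> A \<and> k dvd (x + y) - (u + v) \<longrightarrow> x = u \<and> y = v)"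

text \<open>For odd \<open>k\<close> this is the Skolem bound without halving, which makes it easy
  to scale from \<open>n\<close> and \<open>m\<close> to \<open>n * m\<close>.\<close>

definition short_pairs :: "int \<Rightarrow> (int \<times> int) set \<Rightarrow> bool" where
  "short_pairs k A \<longleftrightarrow> (\<forall>x y. (x, y) \<in> A \<longrightarrow> 2 * \<bar>x - y\<bar> < k)"

text \<open>Two simplifications of \<open>cardioidal_pairs\<close>: the index \<open>i = 0\<close>
  accounts for the extra position \<open>(0, 0)\<close>, and the reduction modulo
  \<open>n * m\<close> is dropped because it changes nothing when \<open>A\<close> and
  \<open>B\<close> are pairings.\<close>

definition product_pairs ::
    "int \<Rightarrow> int \<Rightarrow> (int \<times> int) set \<Rightarrow> (int \<times> int) set \<Rightarrow> (int \<times> int) set" where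
  "product_pairs n m A B =
     {(n * i + x, n * ((2 * i) mod m) + y) | x y i. (x, y) \<in> A \<and> 0 \<le> i \<and> i < m} \<union>
     {(n * r, n * t) | r t. (r, t) \<in> B}"

lemma Zstar_iff: "x \<in> Zstar k \<longleftrightarrow> 0 < x \<and> x < k"
  by (auto simp: Zstar_def)

lemma pairing_range:
  assumes "pairing k A" "(x, y) \<in> A"
  shows "0 < x \<and> x < k \<and> 0 < y \<and> y < k \<and> x \<noteq> y"
  using assms unfolding pairing_def Zstar_iff by blast

lemma pairing_exhaust:
  assumes "pairing k A" "0 < z" "z < k"
  obtains x y where "(x, y) \<in> A" "z = x \<or> z = y"
proof -
  have "z \<in> Zstar k" using assms by (simp add: Zstar_iff)
  then have "\<exists>x y. (x, y) \<in> A \<and> z \<in> {x, y}"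
    using assms(1) unfolding pairing_def by blast
  then show ?thesis using that by blast
qed

lemma pairing_unique:
  assumes "pairing k A" "(x, y) \<in> A" "(u, v) \<in> A" "x = u \<or> x = v \<or> y = u \<or> y = v"
  shows "x = u \<and> y = v"
proof -
  have "{x, y} \<inter> {u, v} \<noteq> {}" using assms(4) by blast
  then show ?thesis
    using assms(1-3) unfolding pairing_def by meson
qed

section \<open>Passing between two-element sets and chosen orderings\<close>

lemma ordering_of_iff: "ordering_of S A \<longleftrightarrow> inj_on unord A \<and> S = unord ` A"
  by (auto simp: ordering_of_def bij_betw_def unord_def)

lemma mem_unord_image: "{x, y} \<in> unord ` A \<longleftrightarrow> (x, y) \<in> A \<or> (y, x) \<in> A"
proof
  assume "{x, y} \<in> unord ` A"
  then show "(x, y) \<in> A \<or> (y, x) \<in> A"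
    by (auto simp: doubleton_eq_iff)
next
  assume "(x, y) \<in> A \<or> (y, x) \<in> A"
  then have "unord (x, y) \<in> unord ` A \<or> unord (y, x) \<in> unord ` A"
    by blast
  then show "{x, y} \<in> unord ` A"
    by (simp add: insert_commute)
qed

lemma inj_on_unordD:
  assumes "inj_on unord A" "(x, y) \<in> A" "(u, v) \<in> A" "{x, y} = {u, v}"
  shows "x = u \<and> y = v"
  using inj_onD[OF assms(1) _ assms(2,3)] assms(4) by simp

text \<open>Once the product is known to be a pairing, this supplies the injectivity under which its
  starter and strong conditions can be read off from ordered pairs.\<close>

lemma pairing_inj:
  assumes "pairing k A"
  shows "inj_on unord A"
  unfolding inj_on_def
proof (intro ballI impI)
  fix p q assume pq: "p \<in> A" "q \<in> A" "unord p = unord q"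
  obtain x y u v where [simp]: "p = (x, y)" "q = (u, v)" by (metis surj_pair)
  have "x = u \<or> x = v \<or> y = u \<or> y = v"
    using pq(3) by (auto simp: doubleton_eq_iff)
  then show "p = q"
    using pairing_unique[OF assms, of x y u v] pq(1,2) by simp
qed

text \<open>Disjointness of blocks only makes two intersecting blocks equal as sets; injectivity of
  \<open>unord\<close> upgrades this to equality of ordered pairs.\<close>

lemma two_partition_iff_pairing:
  assumes "inj_on unord A"
  shows "two_partition k (unord ` A) \<longleftrightarrow> pairing k A"
proof
  assume *: "two_partition k (unord ` A)"
  then have un: "\<Union> (unord ` A) = Zstar k" and dj: "disjoint (unord ` A)"
    and card: "\<And>p. p \<in> unord ` A \<Longrightarrow> card p = 2"
    by (auto simp: two_partition_def partition_on_def)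
  show "pairing k A"
    unfolding pairing_def
  proof (intro conjI allI impI ballI)
    fix x y assume xy: "(x, y) \<in> A"
    then have p: "{x, y} \<in> unord ` A"
      by (simp add: mem_unord_image)
    then show "x \<in> Zstar k" "y \<in> Zstar k"
      using un by blast+
    show "x \<noteq> y"
      using card[OF p] by auto
  next
    fix z assume "z \<in> Zstar k"
    then obtain q where "q \<in> A" "z \<in> unord q"
      using un by blast
    then show "\<exists>x y. (x, y) \<in> A \<and> z \<in> {x, y}"
      by (cases q) auto
  next
    fix x y u v
    assume h: "(x, y) \<in> A \<and> (u, v) \<in> A \<and> {x, y} \<inter> {u, v} \<noteq> {}"
    then have "{x, y} \<in> unord ` A" "{u, v} \<in> unord ` A"
      by (simp_all add: mem_unord_image)
    then have "{x, y} = {u, v}"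
      using dj h unfolding disjoint_def by blast
    then show "x = u" "y = v"
      using inj_on_unordD[OF assms] h by blast+
  qed
next
  assume *: "pairing k A"
  have "\<Union> (unord ` A) = Zstar k"
  proof (intro equalityI subsetI)
    fix z assume "z \<in> \<Union> (unord ` A)"
    then obtain x y where "(x, y) \<in> A" "z = x \<or> z = y" by (auto simp: unord_def)
    then show "z \<in> Zstar k" using pairing_range[OF *] by (auto simp: Zstar_iff)
  next
    fix z assume "z \<in> Zstar k"
    then obtain x y where "(x, y) \<in> A" "z = x \<or> z = y"
      using pairing_exhaust[OF *] Zstar_iff by metis
    then have "(x, y) \<in> A" "z \<in> unord (x, y)" by auto
    then show "z \<in> \<Union> (unord ` A)" by blast
  qed
  moreover have "disjoint (unord ` A)"
  proof (rule disjointI)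
    fix p q assume "p \<in> unord ` A" "q \<in> unord ` A" and ne: "p \<noteq> q"
    then obtain x y u v where "p = {x, y}" "q = {u, v}" "(x, y) \<in> A" "(u, v) \<in> A"
      by (auto simp: unord_def)
    then show "p \<inter> q = {}"
      using pairing_unique[OF *, of x y u v] ne by blast
  qed
  moreover have "\<forall>p\<in>unord ` A. card p = 2"
    using pairing_range[OF *] by (auto simp: unord_def)
  moreover have "{} \<notin> unord ` A"
    by (auto simp: unord_def)
  ultimately show "two_partition k (unord ` A)"
    by (simp add: two_partition_def partition_on_def)
qed

text \<open>Since \<open>s * s = 1\<close>, reversing a pair multiplies \<open>x + s * y\<close> by
  \<open>s\<close>, which is a sign. The sign \<open>e\<close> absorbs it, so looking at one order
  of each pair yields the same set of residues.\<close>

lemma covers_iff: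
  assumes "k > 0" and s: "s = 1 \<or> s = - 1"
  shows "{d. \<exists>x y. {x, y} \<in> unord ` A \<and> (d = (x + s * y) mod k \<or> d = (- (x + s * y)) mod k)} =
           Zstar k \<longleftrightarrow> covers k s A" (is "?D = _ \<longleftrightarrow> _")
proof -
  have D: "?D = {(e * (x + s * y)) mod k | x y e. (x, y) \<in> A \<and> (e = 1 \<or> e = - 1)}"
    (is "_ = ?E")
  proof (intro equalityI subsetI)
    fix d assume "d \<in> ?D"
    then obtain x y where xy: "(x, y) \<in> A \<or> (y, x) \<in> A"
      and "d = (x + s * y) mod k \<or> d = (- (x + s * y)) mod k"
      by (auto simp: mem_unord_image)
    then obtain e where e: "e = 1 \<or> e = - 1" "d = (e * (x + s * y)) mod k"
      by (metis mult_1 mult_minus1)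
    have swap: "e * (x + s * y) = (e * s) * (y + s * x)" "e * s = 1 \<or> e * s = - 1"
      using e(1) s by (auto simp: algebra_simps)
    from xy show "d \<in> ?E"
    proof
      assume "(x, y) \<in> A"
      with e show ?thesis by blast
    next
      assume "(y, x) \<in> A"
      moreover have "d = ((e * s) * (y + s * x)) mod k" using e(2) swap(1) by simp
      ultimately show ?thesis using swap(2) by blast
    qed
  next
    fix d assume "d \<in> ?E"
    then show "d \<in> ?D"
      by (fastforce simp: mem_unord_image)
  qed
  have range: "d mod k \<in> Zstar k \<longleftrightarrow> \<not> k dvd d" for d
    using \<open>k > 0\<close> by (auto simp: Zstar_def dvd_eq_mod_eq_0)
  show ?thesis
    unfolding D
  proof
    assume eq: "?E = Zstar k"
    show "covers k s A"
      unfolding covers_def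
    proof (intro conjI allI impI)
      fix x y assume "(x, y) \<in> A"
      then have "(1 * (x + s * y)) mod k \<in> ?E" by blast
      then show "\<not> k dvd x + s * y"
        using eq range by simp
    next
      fix d assume "\<not> k dvd d"
      then have "d mod k \<in> ?E" using eq range by simp
      then show "\<exists>x y e. (x, y) \<in> A \<and> (e = 1 \<or> e = - 1) \<and> k dvd d - e * (x + s * y)"
        by (auto simp: mod_eq_dvd_iff)
    qed
  next
    assume c: "covers k s A"
    show "?E = Zstar k"
    proof (intro equalityI subsetI)
      fix d assume "d \<in> ?E"
      then obtain x y e where "(x, y) \<in> A" "e = 1 \<or> e = - 1" "d = (e * (x + s * y)) mod k"
        by blast
      moreover from this c have "\<not> k dvd e * (x + s * y)"
        unfolding covers_def by (metis mult_1 mult_minus1 dvd_minus_iff)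
      ultimately show "d \<in> Zstar k"
        using range by simp
    next
      fix d assume d: "d \<in> Zstar k"
      then have dk: "d mod k = d"
        by (simp add: Zstar_def)
      with d range have "\<not> k dvd d" by metis
      then obtain x y e where "(x, y) \<in> A" "e = 1 \<or> e = - 1" "k dvd d - e * (x + s * y)"
        using c unfolding covers_def by blast
      then show "d \<in> ?E"
        using dk by (auto simp flip: mod_eq_dvd_iff)
    qed
  qed
qed

lemma starter_iff:
  assumes "k > 0" "inj_on unord A"
  shows "starter k (unord ` A) \<longleftrightarrow> pairing k A \<and> covers k (- 1) A"
  using covers_iff[OF assms(1), of "- 1" A] two_partition_iff_pairing[OF assms(2)]
  by (simp add: starter_def)

lemma skew_iff:
  assumes "k > 0"
  shows "skew k (unord ` A) \<longleftrightarrow> covers k 1 A"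
  using covers_iff[OF assms, of 1 A] by (simp add: skew_def)

lemma skolem_iff:
  assumes "k > 0" "odd k"
  shows "skolem k (unord ` A) \<longleftrightarrow> short_pairs k A"
proof -
  \<comment> \<open>As \<open>k\<close> is odd, \<open>k - 1\<close> is even and the halving is
    exact.\<close>
  have half: "d \<le> (k - 1) div 2 \<longleftrightarrow> 2 * d < k" for d
    using assms by presburger
  show ?thesis
    unfolding skolem_def short_pairs_def mem_unord_image half
    using \<open>k > 0\<close> by (smt (verit))
qed

lemma strong_iff:
  assumes "inj_on unord A"
  shows "strong k (unord ` A) \<longleftrightarrow> sums_distinct k A"
proof
  assume s: "strong k (unord ` A)"
  show "sums_distinct k A"
    unfolding sums_distinct_def
  proof (intro conjI allI impI)
    fix x y assume "(x, y) \<in> A"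
    then show "\<not> k dvd x + y"
      using s by (auto simp: strong_def mem_unord_image dvd_eq_mod_eq_0)
  next
    fix x y u v
    assume h: "(x, y) \<in> A \<and> (u, v) \<in> A \<and> k dvd (x + y) - (u + v)"
    then have "{x, y} = {u, v}"
      using s unfolding strong_def mem_unord_image by (meson mod_eq_dvd_iff)
    then show "x = u" "y = v"
      using inj_on_unordD[OF assms] h by blast+
  qed
next
  assume s: "sums_distinct k A"
  have nz: "(x + y) mod k \<noteq> 0" if "(x, y) \<in> A" for x y
  proof -
    have "\<not> k dvd x + y"
      using s that unfolding sums_distinct_def by blast
    then show ?thesis by (simp add: dvd_eq_mod_eq_0)
  qed
  have eq: "x = u \<and> y = v" if "(x, y) \<in> A" "(u, v) \<in> A" "(x + y) mod k = (u + v) mod k" for x y u v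
  proof -
    have "k dvd (x + y) - (u + v)"
      using that(3) by (simp add: mod_eq_dvd_iff)
    then show ?thesis
      using s that(1,2) unfolding sums_distinct_def by blast
  qed
  show "strong k (unord ` A)"
    unfolding strong_def mem_unord_image
  proof (intro conjI allI impI)
    fix x y assume "(x, y) \<in> A \<or> (y, x) \<in> A"
    then show "(x + y) mod k \<noteq> 0"
      using nz by (metis add.commute)
  next
    fix x y u v
    assume h: "((x, y) \<in> A \<or> (y, x) \<in> A) \<and> ((u, v) \<in> A \<or> (v, u) \<in> A) \<and> {x, y} \<noteq> {u, v}"
    show "(x + y) mod k \<noteq> (u + v) mod k"
    proof
      assume e: "(x + y) mod k = (u + v) mod k"
      \<comment> \<open>Each of the two sets may be stored in either order. The sum is symmetric, so
        the equation is prepared for all four combinations.\<close>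
      then have e': "(y + x) mod k = (u + v) mod k" "(x + y) mod k = (v + u) mod k"
        "(y + x) mod k = (v + u) mod k"
        by (simp_all add: add.commute)
      from h have "(x, y) \<in> A \<or> (y, x) \<in> A" "(u, v) \<in> A \<or> (v, u) \<in> A" by blast+
      then have "x = u \<and> y = v \<or> x = v \<and> y = u"
        using eq[OF _ _ e] eq[OF _ _ e'(1)] eq[OF _ _ e'(2)] eq[OF _ _ e'(3)] by blast
      with h show False by (auto simp: insert_commute)
    qed
  qed
qed

section \<open>The cardioidal product as a set of ordered pairs\<close>

lemma cardioidal_pairs_eq:
  assumes "n > 0" "m > 0"
    and A: "pairing n A" and B: "pairing m B"
  shows "cardioidal_pairs n m A B = unord ` product_pairs n m A B"
proof -
  have C: "(r, t) \<in> {(0, 0)} \<union> cardioid m \<longleftrightarrow> 0 \<le> r \<and> r < m \<and> t = (2 * r) mod m" for r t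
    using \<open>m > 0\<close> by (cases "r = 0") (auto simp: cardioid_def)
  \<comment> \<open>The largest block starts at \<open>n * (m - 1)\<close>, so
    \<open>n * r + x\<close> stays below \<open>n * m\<close> and is its own residue.\<close>
  have md: "(n * r + x) mod (n * m) = n * r + x" if "0 \<le> r" "r < m" "0 \<le> x" "x < n" for r x
  proof -
    have "n * r \<le> n * (m - 1)"
      using that \<open>n > 0\<close> by (intro mult_left_mono) auto
    then have "n * r + x < n * m"
      using that by (simp add: algebra_simps)
    with that \<open>n > 0\<close> show ?thesis by simp
  qed
  have md0: "(n * r) mod (n * m) = n * r" if "0 \<le> r" "r < m" for r
    using md[of r 0] that \<open>n > 0\<close> by simp
  have A': "0 \<le> x \<and> x < n \<and> 0 \<le> y \<and> y < n" if "(x, y) \<in> A" for x y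
    using pairing_range[OF A that] by simp
  have B': "0 \<le> x \<and> x < m \<and> 0 \<le> y \<and> y < m" if "(x, y) \<in> B" for x y
    using pairing_range[OF B that] by simp
  have "{{(n * r + x) mod (n * m), (n * t + y) mod (n * m)} | x y r t.
            (x, y) \<in> A \<and> (r, t) \<in> {(0, 0)} \<union> cardioid m} =
        unord ` {(n * i + x, n * ((2 * i) mod m) + y) | x y i. (x, y) \<in> A \<and> 0 \<le> i \<and> i < m}"
    (is "?L = ?R")
  proof (intro equalityI subsetI)
    fix p assume "p \<in> ?L"
    then obtain x y r where h: "(x, y) \<in> A" "0 \<le> r" "r < m"
      and p: "p = {(n * r + x) mod (n * m), (n * ((2 * r) mod m) + y) mod (n * m)}"
      unfolding C by blast
    have "p = unord (n * r + x, n * ((2 * r) mod m) + y)"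
      unfolding p using h A'[OF h(1)] \<open>m > 0\<close> by (simp add: md)
    with h show "p \<in> ?R" by blast
  next
    fix p assume "p \<in> ?R"
    then obtain x y r where h: "(x, y) \<in> A" "0 \<le> r" "r < m"
      and p: "p = {n * r + x, n * ((2 * r) mod m) + y}"
      by auto
    have "p = {(n * r + x) mod (n * m), (n * ((2 * r) mod m) + y) mod (n * m)}"
      unfolding p using h A'[OF h(1)] \<open>m > 0\<close> by (simp add: md)
    with h show "p \<in> ?L" unfolding C by blast
  qed
  moreover have "{{(n * r) mod (n * m), (n * t) mod (n * m)} | r t. (r, t) \<in> B} =
        unord ` {(n * r, n * t) | r t. (r, t) \<in> B}" (is "?L = ?R")
  proof (intro equalityI subsetI)
    fix p assume "p \<in> ?L"
    then obtain r t where h: "(r, t) \<in> B" and p: "p = {(n * r) mod (n * m), (n * t) mod (n * m)}"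
      by blast
    have "p = unord (n * r, n * t)"
      unfolding p using B'[OF h] md0 by simp
    with h show "p \<in> ?R" by blast
  next
    fix p assume "p \<in> ?R"
    then obtain r t where h: "(r, t) \<in> B" and p: "p = {n * r, n * t}"
      by auto
    have "p = {(n * r) mod (n * m), (n * t) mod (n * m)}"
      unfolding p using B'[OF h] md0 by simp
    with h show "p \<in> ?L" by blast
  qed
  ultimately show ?thesis
    unfolding cardioidal_pairs_def product_pairs_def image_Un by simp
qed

lemma product_pairsE:
  assumes "(a, b) \<in> product_pairs n m A B"
  obtains (outer) x y i where "(x, y) \<in> A" "0 \<le> i" "i < m"
      "a = n * i + x" "b = n * ((2 * i) mod m) + y"
    | (inner) r t where "(r, t) \<in> B" "a = n * r" "b = n * t"
  using assms unfolding product_pairs_def by blast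

lemma product_pairs_outerI:
  "(x, y) \<in> A \<Longrightarrow> 0 \<le> i \<Longrightarrow> i < m \<Longrightarrow>
     (n * i + x, n * ((2 * i) mod m) + y) \<in> product_pairs n m A B"
  unfolding product_pairs_def by blast

lemma product_pairs_innerI:
  "(r, t) \<in> B \<Longrightarrow> (n * r, n * t) \<in> product_pairs n m A B"
  unfolding product_pairs_def by blast

section \<open>Units modulo \<open>m\<close> and division with remainder by \<open>n\<close>\<close>

lemma residue_eqI:
  fixes c i j m :: int
  assumes "coprime c m" "0 \<le> i" "i < m" "0 \<le> j" "j < m" "m dvd c * i - c * j"
  shows "i = j"
proof -
  have "m dvd c * (i - j)"
    using assms(6) by (simp add: algebra_simps)
  then have "m dvd i - j"
    using assms(1) by (simp add: coprime_dvd_mult_right_iff coprime_commute)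
  then show ?thesis
    using assms(2-5) by (metis mod_eq_dvd_iff mod_pos_pos_trivial)
qed

text \<open>The surjective companion of \<open>residue_eqI\<close>: multiplying by a unit permutes
  the residues. It is applied with \<open>c = 2\<close> to reach a prescribed block by a second
  entry, and with \<open>c = 1 + 2 * s\<close> to reach a prescribed difference or sum.\<close>

lemma residue_solve:
  fixes c m g :: int
  assumes "coprime c m" "m > 0"
  obtains i where "0 \<le> i" "i < m" "m dvd c * i - g"
proof -
  obtain u where "[c * u = 1] (mod m)"
    using assms(1) cong_solve_coprime_int by blast
  then have "[c * u * g = 1 * g] (mod m)"
    by (rule cong_mult) simp
  then have "[c * ((u * g) mod m) = g] (mod m)"
    by (simp add: cong_def mod_mult_right_eq mult.assoc)
  then show ?thesis
    using that[of "(u * g) mod m"] \<open>m > 0\<close> by (simp add: cong_iff_dvd_diff)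
qed

text \<open>Uniqueness of quotient and remainder. It lets every coincidence between product entries
  be split into one of block indices and one of residues modulo \<open>n\<close>.\<close>

lemma block_eqI:
  fixes n :: int
  assumes "n * i + x = n * j + y" "0 \<le> x" "x < n" "0 \<le> y" "y < n"
  shows "i = j \<and> x = y"
proof -
  have "i = (n * i + x) div n"
    using assms(2,3) by simp
  also have "\<dots> = j"
    unfolding assms(1) using assms(4,5) by simp
  finally show ?thesis using assms(1) by simp
qed

lemma block_Zstar:
  assumes "0 \<le> i" "i < m" "0 \<le> x" "x < n" "i \<noteq> 0 \<or> x \<noteq> 0"
  shows "n * i + x \<in> Zstar (n * m)"
proof -
  have "n > 0" using assms by simp
  have "n * i \<le> n * (m - 1)"
    using assms by (intro mult_left_mono) auto
  then have "n * i + x < n * m"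
    using assms by (simp add: algebra_simps)
  moreover have "0 < n * i + x"
    using assms \<open>n > 0\<close> by (cases "i = 0") (auto simp: add_pos_nonneg)
  ultimately show ?thesis by (simp add: Zstar_iff)
qed

lemma double_mod_inj:
  fixes m :: int
  assumes "odd m" "0 \<le> i" "i < m" "0 \<le> j" "j < m" "(2 * i) mod m = (2 * j) mod m"
  shows "i = j"
  using residue_eqI[of 2 m i j] assms by (simp add: mod_eq_dvd_iff)

section \<open>The product partitions the nonzero residues modulo \<open>n * m\<close>\<close>

lemma pairing_product:
  assumes "n > 0" "m > 0" "odd m" and A: "pairing n A" and B: "pairing m B"
  shows "pairing (n * m) (product_pairs n m A B)"
proof -
  note A1 = pairing_range[OF A] and A2 = pairing_exhaust[OF A] and A3 = pairing_unique[OF A]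
  note B1 = pairing_range[OF B] and B2 = pairing_exhaust[OF B] and B3 = pairing_unique[OF B]
  have dm: "0 \<le> (2 * i) mod m" "(2 * i) mod m < m" for i
    using \<open>m > 0\<close> by auto
  show ?thesis
    unfolding pairing_def
  proof (intro conjI allI impI ballI)
    fix a b assume "(a, b) \<in> product_pairs n m A B"
    then have "a \<in> Zstar (n * m) \<and> b \<in> Zstar (n * m) \<and> a \<noteq> b"
    proof (cases rule: product_pairsE)
      case (outer x y i)
      note a = A1[OF outer(1)]
      have "a \<noteq> b"
        using block_eqI[of n i x "(2 * i) mod m" y] a outer(4,5) by auto
      then show ?thesis
        using a outer block_Zstar[of i m x n] block_Zstar[of "(2 * i) mod m" m y n] dm[of i] by auto
    next
      case (inner r t)
      then show ?thesis
        using B1[OF inner(1)] block_Zstar[of r m 0 n] block_Zstar[of t m 0 n] \<open>n > 0\<close> by auto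
    qed
    then show "a \<in> Zstar (n * m)" "b \<in> Zstar (n * m)" "a \<noteq> b" by auto
  next
    fix z assume "z \<in> Zstar (n * m)"
    then have z: "0 < z" "z < n * m" by (auto simp: Zstar_iff)
    \<comment> \<open>The remainder \<open>w\<close> decides the source: multiples of
      \<open>n\<close> come from \<open>B\<close>, all other elements from the pair of
      \<open>A\<close> containing \<open>w\<close>.\<close>
    define j w where "j = z div n" and "w = z mod n"
    have zjw: "z = n * j + w" by (simp add: j_def w_def)
    have w: "0 \<le> w" "w < n" using \<open>n > 0\<close> by (auto simp: w_def)
    have j: "0 \<le> j" using z \<open>n > 0\<close> by (simp add: j_def pos_imp_zdiv_nonneg_iff)
    have "n * j < n * m" using zjw z(2) w(1) by linarith
    then have jm: "j < m" using \<open>n > 0\<close> by simp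
    show "\<exists>x y. (x, y) \<in> product_pairs n m A B \<and> z \<in> {x, y}"
    proof (cases "w = 0")
      case True
      then have "0 < j" using zjw z \<open>n > 0\<close> by (simp add: zero_less_mult_iff)
      then obtain r t where "(r, t) \<in> B" "j = r \<or> j = t" using B2[OF _ jm] by blast
      then show ?thesis
        using product_pairs_innerI[of r t B n m A] zjw True by auto
    next
      case False
      then have "0 < w" using w(1) by simp
      then obtain x y where xy: "(x, y) \<in> A" "w = x \<or> w = y" using A2[OF _ w(2)] by blast
      \<comment> \<open>If \<open>w\<close> is the first entry of its pair, the index is
        \<open>j\<close> itself; if it is the second, the index must satisfy
        \<open>2 * i = j\<close> modulo \<open>m\<close>. Both product pairs are produced, and one
        of them contains \<open>z\<close>.\<close>
      have "coprime 2 m" using \<open>odd m\<close> by simp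
      then obtain i where i: "0 \<le> i" "i < m" "m dvd 2 * i - j"
        using \<open>m > 0\<close> by (rule residue_solve)
      then have "(2 * i) mod m = j"
        using j jm by (metis mod_eq_dvd_iff mod_pos_pos_trivial)
      then have "(n * i + x, n * j + y) \<in> product_pairs n m A B"
        using product_pairs_outerI[OF xy(1) i(1,2), of n B] by simp
      moreover have "(n * j + x, n * ((2 * j) mod m) + y) \<in> product_pairs n m A B"
        by (rule product_pairs_outerI[OF xy(1) j jm])
      moreover have "z = n * j + x \<or> z = n * j + y"
        using xy(2) zjw by blast
      ultimately show ?thesis by blast
    qed
  next
    fix a b c d
    assume "(a, b) \<in> product_pairs n m A B \<and> (c, d) \<in> product_pairs n m A B \<and>
      {a, b} \<inter> {c, d} \<noteq> {}"
    then have p: "(a, b) \<in> product_pairs n m A B" and q: "(c, d) \<in> product_pairs n m A B"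
      and e: "a = c \<or> a = d \<or> b = c \<or> b = d" by auto
    from p have "a = c \<and> b = d"
    proof (cases rule: product_pairsE)
      case p: (outer x y i)
      note px = A1[OF p(1)]
      from q show ?thesis
      proof (cases rule: product_pairsE)
        case q: (outer u v j)
        note qx = A1[OF q(1)]
        have e': "i = j \<and> x = u \<or> i = (2 * j) mod m \<and> x = v \<or>
            (2 * i) mod m = j \<and> y = u \<or> (2 * i) mod m = (2 * j) mod m \<and> y = v"
          using e unfolding p(4,5) q(4,5)
          using px qx block_eqI[of n i x j u] block_eqI[of n i x "(2 * j) mod m" v]
            block_eqI[of n "(2 * i) mod m" y j u] block_eqI[of n "(2 * i) mod m" y "(2 * j) mod m" v]
          by auto
        then have xy: "x = u \<and> y = v" using A3[OF p(1) q(1)] by blast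
        \<comment> \<open>With \<open>x = u\<close> and \<open>y = v\<close>, the two crosswise
          cases of \<open>e'\<close> would force \<open>x = y\<close>. The remaining cases give
          \<open>i = j\<close> directly or after cancelling the factor 2.\<close>
        then have "i = j"
          using e' px double_mod_inj[OF \<open>odd m\<close> p(2,3) q(2,3)] by auto
        with xy show ?thesis using p q by simp
      next
        case q: (inner r t)
        \<comment> \<open>Contradictory case: outer entries have nonzero remainder modulo
          \<open>n\<close>, inner entries remainder 0.\<close>
        show ?thesis
          using e unfolding p(4,5) q(2,3)
          using px block_eqI[of n i x r 0] block_eqI[of n i x t 0]
            block_eqI[of n "(2 * i) mod m" y r 0] block_eqI[of n "(2 * i) mod m" y t 0]
          by auto
      qed
    next
      case p: (inner r t)
      from q show ?thesis
      proof (cases rule: product_pairsE)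
        case q: (outer x y i)
        note px = A1[OF q(1)]
        show ?thesis
          using e unfolding q(4,5) p(2,3)
          using px block_eqI[of n i x r 0] block_eqI[of n i x t 0]
            block_eqI[of n "(2 * i) mod m" y r 0] block_eqI[of n "(2 * i) mod m" y t 0]
          by auto
      next
        case q: (inner u v)
        have "r = u \<or> r = v \<or> t = u \<or> t = v"
          using e p q \<open>n > 0\<close> by simp
        then have "r = u \<and> t = v" using B3[OF p(1) q(1)] by blast
        then show ?thesis using p q by simp
      qed
    qed
    then show "a = c" "b = d" by auto
  qed
qed

section \<open>Differences and sums of the product pairs\<close>

lemma outer_combination:
  fixes n m s i x y :: int
  obtains k where "(n * i + x) + s * (n * ((2 * i) mod m) + y) =
      n * ((1 + 2 * s) * i) + (x + s * y) + n * m * k"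
proof -
  obtain k where k: "(2 * i) mod m = 2 * i - m * k"
    by (metis minus_mult_div_eq_mod)
  \<comment> \<open>Replacing \<open>(2 * i) mod m\<close> by \<open>2 * i - m * k\<close> turns the
    block part into \<open>(1 + 2 * s) * i\<close> up to a multiple of \<open>m\<close>: the factor
    is -1 for differences and 3 for sums.\<close>
  have "(n * i + x) + s * (n * ((2 * i) mod m) + y) =
      n * ((1 + 2 * s) * i) + (x + s * y) + n * m * (- s * k)"
    unfolding k by (simp add: algebra_simps)
  then show ?thesis by (rule that)
qed

text \<open>A target \<open>d\<close> divisible by \<open>n\<close> is divided by \<open>n\<close>
  and handled by \<open>B\<close>. Otherwise \<open>A\<close> matches \<open>d\<close> modulo
  \<open>n\<close>, and the leftover multiple of \<open>n\<close> is matched by choosing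
  \<open>i\<close>, which is possible because \<open>1 + 2 * s\<close> is a unit modulo
  \<open>m\<close>.\<close>

lemma covers_product:
  assumes "n > 0" "m > 0" and cop: "coprime (1 + 2 * s) m"
    and A: "covers n s A" and B: "covers m s B"
  shows "covers (n * m) s (product_pairs n m A B)"
  unfolding covers_def
proof (intro conjI allI impI)
  fix a b assume "(a, b) \<in> product_pairs n m A B"
  then show "\<not> n * m dvd a + s * b"
  proof (cases rule: product_pairsE)
    case (outer x y i)
    obtain k where k: "a + s * b = n * ((1 + 2 * s) * i) + (x + s * y) + n * m * k"
      unfolding outer(4,5) by (rule outer_combination)
    \<comment> \<open>Modulo \<open>n\<close> only \<open>x + s * y\<close> survives, so already
      \<open>n\<close> does not divide the combination.\<close>
    have "a + s * b = (x + s * y) + n * ((1 + 2 * s) * i + m * k)"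
      unfolding k by (simp add: algebra_simps)
    then have "n dvd a + s * b \<longleftrightarrow> n dvd x + s * y"
      by (metis dvd_add_times_triv_right_iff mult.commute)
    then show ?thesis
      using A outer(1) unfolding covers_def by (metis dvd_mult_left)
  next
    case (inner r t)
    have "a + s * b = n * (r + s * t)"
      using inner by (simp add: algebra_simps)
    then show ?thesis
      using B inner(1) \<open>n > 0\<close> unfolding covers_def by simp
  qed
next
  fix d assume d: "\<not> n * m dvd d"
  show "\<exists>a b e. (a, b) \<in> product_pairs n m A B \<and> (e = 1 \<or> e = - 1) \<and>
      n * m dvd d - e * (a + s * b)"
  proof (cases "n dvd d")
    case True
    then obtain d' where d': "d = n * d'" by blast
    then have "\<not> m dvd d'" using d by simp
    then obtain r t e where rt: "(r, t) \<in> B" "e = 1 \<or> e = - 1" "m dvd d' - e * (r + s * t)"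
      using B unfolding covers_def by blast
    have "n * m dvd n * (d' - e * (r + s * t))"
      using rt(3) by (rule mult_dvd_mono[OF dvd_refl])
    also have "n * (d' - e * (r + s * t)) = d - e * (n * r + s * (n * t))"
      by (simp add: d' algebra_simps)
    finally show ?thesis
      using rt product_pairs_innerI by blast
  next
    case False
    then obtain x y e where xy: "(x, y) \<in> A" "e = 1 \<or> e = - 1" "n dvd d - e * (x + s * y)"
      using A unfolding covers_def by blast
    then obtain g where g: "d - e * (x + s * y) = n * g" by blast
    \<comment> \<open>The quantity to be met is \<open>e * (1 + 2 * s) * i = g\<close> modulo
      \<open>m\<close>; since \<open>e * e = 1\<close>, the sign is moved to the right-hand
      side.\<close>
    obtain i where i: "0 \<le> i" "i < m" "m dvd (1 + 2 * s) * i - e * g"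
      using residue_solve[OF cop \<open>m > 0\<close>] by blast
    obtain k where k: "(n * i + x) + s * (n * ((2 * i) mod m) + y) =
        n * ((1 + 2 * s) * i) + (x + s * y) + n * m * k"
      by (rule outer_combination)
    have "d - e * ((n * i + x) + s * (n * ((2 * i) mod m) + y)) =
        n * (g - e * ((1 + 2 * s) * i)) - n * m * (e * k)"
      unfolding k using g by (simp add: algebra_simps)
    also have "g - e * ((1 + 2 * s) * i) = - e * ((1 + 2 * s) * i - e * g)"
      using xy(2) by auto
    also have "n * m dvd n * (- e * ((1 + 2 * s) * i - e * g)) - n * m * (e * k)"
      by (rule dvd_diff[OF mult_dvd_mono[OF dvd_refl dvd_mult[OF i(3)]] dvd_triv_left])
    finally show ?thesis
      using product_pairs_outerI[OF xy(1) i(1,2)] xy(2) by blast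
  qed
qed

text \<open>Congruent sums agree modulo \<open>n\<close>, which forces the same type and, for outer
  pairs, the same \<open>(x, y)\<close>. After cancelling \<open>n\<close>, outer pairs satisfy
  \<open>3 * i = 3 * j\<close> modulo \<open>m\<close>, where 3 is a unit, and inner pairs are
  settled by \<open>B\<close>.\<close>

lemma sums_distinct_product:
  assumes "n > 0" and cop: "coprime 3 m"
    and A: "sums_distinct n A" and B: "sums_distinct m B"
  shows "sums_distinct (n * m) (product_pairs n m A B)"
proof -
  have outer_sum: "\<exists>k. (n * i + x) + (n * ((2 * i) mod m) + y) = n * (3 * i) + (x + y) + n * m * k"
    for i x y
    using outer_combination[where n = n and i = i and x = x and s = 1 and m = m and y = y] by auto
  \<comment> \<open>The block indices are left arbitrary because they are invisible modulo
    \<open>n\<close>.\<close>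
  have nz: "\<not> n dvd (n * i + x) + (n * j + y)" if "(x, y) \<in> A" for x y i j
  proof -
    have "(n * i + x) + (n * j + y) = (x + y) + n * (i + j)"
      by (simp add: algebra_simps)
    then have "n dvd (n * i + x) + (n * j + y) \<longleftrightarrow> n dvd x + y"
      by (metis dvd_add_times_triv_right_iff mult.commute)
    then show ?thesis
      using A that unfolding sums_distinct_def by blast
  qed
  show ?thesis
    unfolding sums_distinct_def
  proof (intro conjI allI impI)
    fix a b assume "(a, b) \<in> product_pairs n m A B"
    then show "\<not> n * m dvd a + b"
    proof (cases rule: product_pairsE)
      case (outer x y i)
      then show ?thesis using nz[of x y i] by (metis dvd_mult_left)
    next
      case (inner r t)
      then have "a + b = n * (r + t)" by (simp add: algebra_simps)
      then show ?thesis
        using B inner(1) \<open>n > 0\<close> unfolding sums_distinct_def by simp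
    qed
  next
    fix a b c d
    assume h: "(a, b) \<in> product_pairs n m A B \<and> (c, d) \<in> product_pairs n m A B \<and>
      n * m dvd a + b - (c + d)"
    then have p: "(a, b) \<in> product_pairs n m A B" and q: "(c, d) \<in> product_pairs n m A B"
      and e: "n * m dvd a + b - (c + d)" by auto
    from e have en: "n dvd a + b - (c + d)" by (rule dvd_mult_left)
    \<comment> \<open>This excludes the mixed cases: inner sums are divisible by \<open>n\<close>,
      outer sums are not.\<close>
    then have en': "n dvd a + b \<longleftrightarrow> n dvd c + d"
      by (metis dvd_add_right_iff diff_add_cancel)
    from p have "a = c \<and> b = d"
    proof (cases rule: product_pairsE)
      case p: (outer x y i)
      have "\<not> n dvd a + b" using nz p by simp
      from q show ?thesis
      proof (cases rule: product_pairsE)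
        case q: (outer u v j)
        obtain k where k: "a + b = n * (3 * i) + (x + y) + n * m * k"
          unfolding p(4,5) using outer_sum by blast
        obtain l where l: "c + d = n * (3 * j) + (u + v) + n * m * l"
          unfolding q(4,5) using outer_sum by blast
        have "a + b - (c + d) = (x + y - (u + v)) + n * (3 * i - 3 * j + m * (k - l))"
          unfolding k l by (simp add: algebra_simps)
        then have "n dvd x + y - (u + v)"
          using en by (metis dvd_add_times_triv_right_iff mult.commute)
        then have xy: "x = u \<and> y = v"
          using A p(1) q(1) unfolding sums_distinct_def by blast
        then have "a + b - (c + d) = n * (3 * i - 3 * j + m * (k - l))"
          unfolding k l by (simp add: algebra_simps)
        then have "m dvd (3 * i - 3 * j) + m * (k - l)"
          using e \<open>n > 0\<close> by simp
        then have "m dvd 3 * i - 3 * j"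
          by (metis dvd_add_times_triv_right_iff mult.commute)
        then have "i = j"
          using residue_eqI[OF cop p(2,3) q(2,3)] by simp
        with xy show ?thesis using p q by simp
      next
        case q: (inner r t)
        then have "n dvd c + d" by simp
        with en' \<open>\<not> n dvd a + b\<close> show ?thesis by simp
      qed
    next
      case p: (inner r t)
      then have "n dvd a + b" by simp
      from q show ?thesis
      proof (cases rule: product_pairsE)
        case q: (outer x y i)
        then have "\<not> n dvd c + d" using nz by simp
        with en' \<open>n dvd a + b\<close> show ?thesis by simp
      next
        case q: (inner u v)
        have "a + b - (c + d) = n * (r + t - (u + v))"
          unfolding p q by (simp add: algebra_simps)
        then have "m dvd r + t - (u + v)" using e \<open>n > 0\<close> by simp
        then have "r = u \<and> t = v"
          using B p(1) q(1) unfolding sums_distinct_def by blast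
        then show ?thesis using p q by simp
      qed
    qed
    then show "a = c" "b = d" by auto
  qed
qed

section \<open>The Skolem bound for the product\<close>

lemma block_distance:
  fixes n m g h :: int
  assumes "n > 0" "2 * \<bar>g\<bar> < m" "2 * \<bar>h\<bar> < n"
  shows "2 * \<bar>n * g + h\<bar> < n * m"
proof -
  \<comment> \<open>Integrality leaves a gap of 1, which after scaling by \<open>n\<close> makes
    room for \<open>2 * \<bar>h\<bar> < n\<close>.\<close>
  have "2 * \<bar>g\<bar> + 1 \<le> m" using assms by simp
  then have "n * (2 * \<bar>g\<bar> + 1) \<le> n * m"
    using \<open>n > 0\<close> by (intro mult_left_mono) auto
  moreover have "\<bar>n * g + h\<bar> \<le> n * \<bar>g\<bar> + \<bar>h\<bar>"
    using abs_triangle_ineq[of "n * g" h] \<open>n > 0\<close> by (simp add: abs_mult)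
  ultimately show ?thesis
    using assms(3) by (simp add: algebra_simps)
qed

text \<open>The distance is \<open>i\<close> when \<open>2 * i < m\<close> and \<open>m - i\<close>
  otherwise. In the second case \<open>2 * i = m\<close> is impossible by parity, so the inequality
  is strict.\<close>

lemma double_mod_distance:
  fixes i m :: int
  assumes "0 \<le> i" "i < m" "odd m"
  shows "2 * \<bar>i - (2 * i) mod m\<bar> < m"
proof (cases "2 * i < m")
  case True
  then show ?thesis using assms by simp
next
  case False
  then have "(2 * i) mod m = 2 * i - m"
    using assms mod_pos_pos_trivial[of "2 * i - m" m] minus_mod_self2[of "2 * i" m] by simp
  moreover have "2 * i \<noteq> m" using assms by auto
  ultimately show ?thesis using assms False by (simp add: abs_if)
qed

lemma short_pairs_product:
  assumes "n > 0" "odd m" and A: "short_pairs n A" and B: "short_pairs m B"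
  shows "short_pairs (n * m) (product_pairs n m A B)"
  unfolding short_pairs_def
proof (intro allI impI)
  fix a b assume "(a, b) \<in> product_pairs n m A B"
  then show "2 * \<bar>a - b\<bar> < n * m"
  proof (cases rule: product_pairsE)
    case (outer x y i)
    have "a - b = n * (i - (2 * i) mod m) + (x - y)"
      unfolding outer(4,5) by (simp add: algebra_simps)
    then show ?thesis
      using block_distance[OF \<open>n > 0\<close> double_mod_distance[OF outer(2,3) \<open>odd m\<close>], of "x - y"]
        A outer(1) by (simp add: short_pairs_def)
  next
    case (inner r t)
    have "a - b = n * (r - t) + 0"
      unfolding inner by (simp add: algebra_simps)
    then show ?thesis
      using block_distance[OF \<open>n > 0\<close>, of "r - t" m 0] B inner(1) \<open>n > 0\<close>
      by (simp add: short_pairs_def)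
  qed
qed

section \<open>Combining the conditions for an arbitrary choice of orderings\<close>

lemma cardioidal_product_cases:
  assumes "cardioidal_product n m S T W" "n > 0" "m > 0" "odd m" "starter n S" "starter m T"
  obtains A B where "inj_on unord A" "S = unord ` A" "inj_on unord B" "T = unord ` B"
    "W = unord ` product_pairs n m A B" "inj_on unord (product_pairs n m A B)"
proof -
  obtain A B where A: "inj_on unord A" "S = unord ` A" and B: "inj_on unord B" "T = unord ` B"
    and W: "W = cardioidal_pairs n m A B"
    using assms(1) unfolding cardioidal_product_def ordering_of_iff by blast
  \<comment> \<open>The starter hypotheses enter here: they keep the entries in range, so the outer
    reduction vanishes, and they make the product a pairing, hence injective under
    \<open>unord\<close>.\<close>
  have "pairing n A" "pairing m B"
    using assms A B starter_iff by blast+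
  then show ?thesis
    using that[OF A B] W cardioidal_pairs_eq[of n m A B] pairing_inj[OF pairing_product] assms(2-4)
    by blast
qed

theorem theorem3p26:
  fixes n m :: int and S T :: "int set set"
  assumes "n \<ge> 3" and "m \<ge> 3" and "odd n" and "odd m" and "\<not> 3 dvd m"
  shows "(strong_skolem_starter n S \<and> strong_skolem_starter m T \<longrightarrow>
            (\<forall>W. cardioidal_product n m S T W \<longrightarrow> strong_skolem_starter (m * n) W)) \<and>
         (skew_skolem_starter n S \<and> skew_skolem_starter m T \<longrightarrow>
            (\<forall>W. cardioidal_product n m S T W \<longrightarrow> skew_skolem_starter (m * n) W))"
proof -
  have pos: "n > 0" "m > 0" "n * m > 0" and odd: "odd (n * m)"
    using assms by auto
  have "prime (3 :: int)" by simp
  then have cop3: "coprime 3 m"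
    using \<open>\<not> 3 dvd m\<close> by (rule prime_imp_coprime)
  have cop1: "coprime (1 + 2 * - 1) m" by simp
  \<comment> \<open>The starter and Skolem properties are common to both halves of the claim, so
    they are derived once, with the strong and skew properties as separate implications.\<close>
  have main: "starter (n * m) W \<and> skolem (n * m) W \<and>
      (strong n S \<and> strong m T \<longrightarrow> strong (n * m) W) \<and> (skew n S \<and> skew m T \<longrightarrow> skew (n * m) W)"
    if st: "starter n S" "starter m T" and sk: "skolem n S" "skolem m T"
      and W: "cardioidal_product n m S T W" for W
  proof -
    obtain A B where A: "inj_on unord A" "S = unord ` A" and B: "inj_on unord B" "T = unord ` B"
      and P: "W = unord ` product_pairs n m A B" "inj_on unord (product_pairs n m A B)"
      by (rule cardioidal_product_cases[OF W pos(1,2) \<open>odd m\<close> st])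
    have "starter (n * m) W"
      using st pairing_product[OF pos(1,2) \<open>odd m\<close>, of A B] covers_product[OF pos(1,2) cop1, of A B]
      unfolding P(1) A(2) B(2) starter_iff[OF pos(1) A(1)] starter_iff[OF pos(2) B(1)]
        starter_iff[OF pos(3) P(2)] by blast
    moreover have "skolem (n * m) W"
      using sk short_pairs_product[OF pos(1) \<open>odd m\<close>]
      unfolding P(1) A(2) B(2) skolem_iff[OF pos(1) \<open>odd n\<close>] skolem_iff[OF pos(2) \<open>odd m\<close>]
        skolem_iff[OF pos(3) odd] by blast
    moreover have "strong n S \<and> strong m T \<longrightarrow> strong (n * m) W"
      using sums_distinct_product[OF pos(1) cop3]
      unfolding P(1) A(2) B(2) strong_iff[OF A(1)] strong_iff[OF B(1)] strong_iff[OF P(2)] by blast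
    \<comment> \<open>The instance \<open>s = 1\<close> of the covering argument, whose multiplier
      \<open>1 + 2 * 1\<close> is the unit 3.\<close>
    moreover have "skew n S \<and> skew m T \<longrightarrow> skew (n * m) W"
      using covers_product[OF pos(1,2), of 1 A B] cop3
      unfolding P(1) A(2) B(2) skew_iff[OF pos(1)] skew_iff[OF pos(2)] skew_iff[OF pos(3)] by simp
    ultimately show ?thesis by blast
  qed
  show ?thesis
    unfolding strong_skolem_starter_def skew_skolem_starter_def mult.commute[of m n]
    using main by blast
qed

end
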